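(* Fix integers $r>s\ge1$. Then $M_{r,s,\infty}$ and $B_{r,s,\infty}$ are subgroups of $\mathrm{Aut}(T_\infty)$. Moreover, $P_{r,s}:M_{r,s,\infty}\to\mathbb{Z}/2\mathbb{Z}$ is a homomorphism with kernel $B_{r,s,\infty}$.
   Context: $T_\infty$ is the infinite binary rooted tree whose nodes are finite words in $\{a,b\}$ (root = empty word, $w$ joined to $wa,wb$); $\mathrm{Aut}(T_\infty)$ is its automorphism group (length- and prefix-preserving permutations of words). For $\sigma\in\mathrm{Aut}(T_\infty)$ and a word $x$, $\mathrm{Par}(\sigma,x)\in\mathbb{Z}/2\mathbb{Z}$ is $0$ if $\sigma(xa)=\sigma(x)a$ and $1$ if $\sigma(xa)=\sigma(x)b$. Define $P^a_{r,s}(\sigma,x)=\sum_{w\in\{a,b\}^{r-1}}\mathrm{Par}(\sigma,xaw)+\sum_{w'\in\{a,b\}^{s-1}}\mathrm{Par}(\sigma,xbw')$ and $P^b_{r,s}(\sigma,x)=\sum_{w\in\{a,b\}^{r-1}}\mathrm{Par}(\sigma,xbw)+\sum_{w'\in\{a,b\}^{s-1}}\mathrm{Par}(\sigma,xaw')$ in $\mathbb{Z}/2\mathbb{Z}$. $M_{r,s,\infty}$ is the set of $\sigma\in\mathrm{Aut}(T_\infty)$ such that $P^a_{r,s}(\sigma,x_1)=P^b_{r,s}(\sigma,x_1)=P^a_{r,s}(\sigma,x_2)=P^b_{r,s}(\sigma,x_2)$ for all nodes $x_1,x_2$; for such $\sigma$, $P_{r,s}(\sigma)$ is this common value, and $B_{r,s,\infty}=\{\sigma\in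 M_{r,s,\infty}:P_{r,s}(\sigma)=0\}$. *)

theory Defs
  imports "HOL-Algebra.Coset" "HOL-Library.Sublist" "HOL-Library.Z2"
begin

datatype letter = LetA | LetB

text \<open>A node of the infinite binary rooted tree is a finite word; the word \<open>x\<close> has the
  children \<open>x @ [LetA]\<close> and \<open>x @ [LetB]\<close>.\<close>

type_synonym node = "letter list"

definition words :: "nat \<Rightarrow> node set" where
  "words n = {w. length w = n}"

lemma finite_words: "finite (words n)"
proof -
  have "finite (UNIV :: letter set)"
    by (rule finite_subset[of _ "{LetA, LetB}"]) (auto intro: letter.exhaust)
  from finite_lists_length_eq[OF this, of n] show ?thesis by (simp add: words_def)
qed

definition tree_automorphisms :: "(node \<Rightarrow> node) set" where
  "tree_automorphisms = {\<sigma>. bij \<sigma> \<and> (\<forall>x. length (\<sigma> x) = length x) \<and>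
     (\<forall>x y. prefix x y \<longrightarrow> prefix (\<sigma> x) (\<sigma> y))}"

definition AutT :: "(node \<Rightarrow> node) monoid" where
  "AutT = \<lparr>carrier = tree_automorphisms, mult = (\<circ>), one = id\<rparr>"

text \<open>\<open>\<int>/2\<int>\<close>: the additive group of the two-element field \<^typ>\<open>bit\<close>.\<close>

definition Z2_group :: "bit monoid" where
  "Z2_group = \<lparr>carrier = UNIV, mult = (+), one = 0\<rparr>"

text \<open>For a tree automorphism the second case is exactly
  \<open>\<sigma> (x @ [LetA]) = \<sigma> x @ [LetB]\<close>; see \<open>Par_eq_1_iff\<close>.\<close>

definition Par :: "(node \<Rightarrow> node) \<Rightarrow> node \<Rightarrow> bit" where
  "Par \<sigma> x = (if \<sigma> (x @ [LetA]) = \<sigma> x @ [LetA] then 0 else 1)"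

definition Pa :: "nat \<Rightarrow> nat \<Rightarrow> (node \<Rightarrow> node) \<Rightarrow> node \<Rightarrow> bit" where
  "Pa r s \<sigma> x = (\<Sum>w\<in>words (r - 1). Par \<sigma> (x @ [LetA] @ w))
             + (\<Sum>w\<in>words (s - 1). Par \<sigma> (x @ [LetB] @ w))"

definition Pb :: "nat \<Rightarrow> nat \<Rightarrow> (node \<Rightarrow> node) \<Rightarrow> node \<Rightarrow> bit" where
  "Pb r s \<sigma> x = (\<Sum>w\<in>words (r - 1). Par \<sigma> (x @ [LetB] @ w))
             + (\<Sum>w\<in>words (s - 1). Par \<sigma> (x @ [LetA] @ w))"

definition Mrs :: "nat \<Rightarrow> nat \<Rightarrow> (node \<Rightarrow> node) set" where
  "Mrs r s = {\<sigma> \<in> carrier AutT. \<forall>x\<^sub>1 x\<^sub>2. Pa r s \<sigma> x\<^sub>1 = Pb r s \<sigma> x\<^sub>1 \<and>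
     Pb r s \<sigma> x\<^sub>1 = Pa r s \<sigma> x\<^sub>2 \<and> Pa r s \<sigma> x\<^sub>2 = Pb r s \<sigma> x\<^sub>2}"

text \<open>The common value; only meaningful for \<open>\<sigma> \<in> Mrs r s\<close>, see \<open>Prs_eq\<close>.\<close>

definition Prs :: "nat \<Rightarrow> nat \<Rightarrow> (node \<Rightarrow> node) \<Rightarrow> bit" where
  "Prs r s \<sigma> = (THE p. \<forall>x. Pa r s \<sigma> x = p \<and> Pb r s \<sigma> x = p)"

definition Brs :: "nat \<Rightarrow> nat \<Rightarrow> (node \<Rightarrow> node) set" where
  "Brs r s = {\<sigma> \<in> Mrs r s. Prs r s \<sigma> = 0}"

lemma Prs_eq:
  assumes "\<sigma> \<in> Mrs r s"
  shows "Pa r s \<sigma> x = Prs r s \<sigma>" "Pb r s \<sigma> x = Prs r s \<sigma>"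
proof -
  have c: "\<forall>x. Pa r s \<sigma> x = Pa r s \<sigma> [] \<and> Pb r s \<sigma> x = Pa r s \<sigma> []"
    using assms unfolding Mrs_def by (metis (mono_tags, lifting) mem_Collect_eq)
  then have "Prs r s \<sigma> = Pa r s \<sigma> []"
    unfolding Prs_def by (intro the_equality) auto
  with c show "Pa r s \<sigma> x = Prs r s \<sigma>" "Pb r s \<sigma> x = Prs r s \<sigma>" by auto
qed

lemma tree_automorphism_prefix_iff:
  assumes "\<sigma> \<in> tree_automorphisms"
  shows "prefix (\<sigma> x) (\<sigma> y) \<longleftrightarrow> prefix x y"
proof
  assume p: "prefix (\<sigma> x) (\<sigma> y)"
  have len: "\<And>x. length (\<sigma> x) = length x" and inj: "inj \<sigma>"
    and pre: "\<And>x y. prefix x y \<Longrightarrow> prefix (\<sigma> x) (\<sigma> y)"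
    using assms by (auto simp: tree_automorphisms_def bij_def)
  let ?x = "take (length x) y"
  have "length x \<le> length y" using prefix_length_le[OF p] len by simp
  then have l: "length (\<sigma> ?x) = length (\<sigma> x)" by (simp add: len)
  have "prefix (\<sigma> ?x) (\<sigma> y)" by (intro pre take_is_prefix)
  with p l have "\<sigma> ?x = \<sigma> x" by (auto simp: prefix_def append_eq_append_conv)
  then have "?x = x" using inj by (simp add: inj_eq)
  then show "prefix x y" by (metis take_is_prefix)
qed (use assms in \<open>auto simp: tree_automorphisms_def\<close>)

lemma Par_eq_1_iff:
  assumes "\<sigma> \<in> tree_automorphisms"
  shows "Par \<sigma> x = 1 \<longleftrightarrow> \<sigma> (x @ [LetA]) = \<sigma> x @ [LetB]"
proof -
  have "prefix (\<sigma> x) (\<sigma> (x @ [LetA]))" "length (\<sigma> (x @ [LetA])) = Suc (length (\<sigma> x))"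
    using assms by (auto simp: tree_automorphisms_def)
  then obtain zs where zs: "\<sigma> (x @ [LetA]) = \<sigma> x @ zs"
    and "length (\<sigma> x @ zs) = Suc (length (\<sigma> x))"
    by (elim prefixE) simp
  then have "length zs = Suc 0" by simp
  with zs obtain c where "\<sigma> (x @ [LetA]) = \<sigma> x @ [c]"
    by (auto simp: length_Suc_conv)
  then show ?thesis by (cases c) (auto simp: Par_def)
qed

lemma group_AutT: "group AutT"
proof (rule groupI)
  fix \<sigma> assume "\<sigma> \<in> carrier AutT"
  then have \<sigma>: "\<sigma> \<in> tree_automorphisms" by (simp add: AutT_def)
  then have bij: "bij \<sigma>" and len: "\<And>x. length (\<sigma> x) = length x"
    by (auto simp: tree_automorphisms_def)
  have "inv_into UNIV \<sigma> \<in> tree_automorphisms"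
    unfolding tree_automorphisms_def
  proof (intro CollectI conjI allI impI)
    show "bij (inv_into UNIV \<sigma>)" using bij by (rule bij_imp_bij_inv)
    show "length (inv_into UNIV \<sigma> x) = length x" for x
      by (metis bij bij_inv_eq_iff len)
    show "prefix (inv_into UNIV \<sigma> x) (inv_into UNIV \<sigma> y)" if "prefix x y" for x y
      using that tree_automorphism_prefix_iff[OF \<sigma>] by (metis bij bij_inv_eq_iff)
  qed
  moreover have "inv_into UNIV \<sigma> \<circ> \<sigma> = id" using bij by (simp add: bij_def)
  ultimately show "\<exists>\<tau>\<in>carrier AutT. \<tau> \<otimes>\<^bsub>AutT\<^esub> \<sigma> = \<one>\<^bsub>AutT\<^esub>"
    by (auto simp: AutT_def)
qed (auto simp: AutT_def tree_automorphisms_def bij_comp comp_assoc)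

lemma group_Z2_group: "group Z2_group"
  by (rule groupI) (auto simp: Z2_group_def add.assoc)

end

theory Submission imports Defs begin

text \<open>Parity is a cocycle, \<open>Par (\<sigma> \<circ> \<tau>) x = Par \<tau> x + Par \<sigma> (\<tau> x)\<close>. Summing over the words
  below a node keeps this form, as \<open>\<tau>\<close> permutes each level of the subtrees. Since \<open>\<tau>\<close> either
  preserves or swaps the two children of \<open>x\<close>, \<open>Pa (\<sigma> \<circ> \<tau>) x\<close> is \<open>Pa \<tau> x\<close> plus one of
  \<open>Pa \<sigma> (\<tau> x)\<close>, \<open>Pb \<sigma> (\<tau> x)\<close>; these two agree when \<open>\<sigma>\<close> lies in \<open>Mrs r s\<close>.\<close>

lemma tree_automorphism_append:
  assumes "\<sigma> \<in> tree_automorphisms"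
  obtains v where "\<sigma> (x @ w) = \<sigma> x @ v" "length v = length w"
proof -
  have "prefix (\<sigma> x) (\<sigma> (x @ w))" and len: "\<And>y. length (\<sigma> y) = length y"
    using assms by (auto simp: tree_automorphisms_def)
  then obtain v where v: "\<sigma> (x @ w) = \<sigma> x @ v" by (auto elim: prefixE)
  moreover have "length v = length w"
    using arg_cong[OF v, of length] by (simp add: len)
  ultimately show thesis using that by blast
qed

lemma tree_automorphism_inj:
  "\<sigma> \<in> tree_automorphisms \<Longrightarrow> \<sigma> x = \<sigma> y \<longleftrightarrow> x = y"
  by (auto simp: tree_automorphisms_def dest: bij_is_inj injD)

text \<open>Each child of \<open>x\<close> goes to a child of \<open>\<sigma> x\<close>, and
  injectivity keeps the two images distinct, so only the identity and the swap remain.\<close>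

lemma tree_automorphism_children:
  assumes "\<sigma> \<in> tree_automorphisms"
  shows "\<sigma> (x @ [LetA]) = \<sigma> x @ [LetA] \<and> \<sigma> (x @ [LetB]) = \<sigma> x @ [LetB] \<or>
         \<sigma> (x @ [LetA]) = \<sigma> x @ [LetB] \<and> \<sigma> (x @ [LetB]) = \<sigma> x @ [LetA]"
proof -
  have child: "\<exists>d. \<sigma> (x @ [c]) = \<sigma> x @ [d]" for c
    using tree_automorphism_append[OF assms, of x "[c]"] by (auto simp: length_Suc_conv)
  obtain d e where de: "\<sigma> (x @ [LetA]) = \<sigma> x @ [d]" "\<sigma> (x @ [LetB]) = \<sigma> x @ [e]"
    using child by blast
  moreover have "d \<noteq> e"
    using tree_automorphism_inj[OF assms, of "x @ [LetA]" "x @ [LetB]"] de by auto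
  ultimately show ?thesis by (cases d; cases e) auto
qed

text \<open>Swaps compose like elements of \<open>bit\<close>: a swap by \<open>\<tau>\<close> below
  \<open>x\<close> followed by one by \<open>\<sigma>\<close> below \<open>\<tau> x\<close> cancels,
  matching 1 + 1 = 0.\<close>

lemma Par_comp:
  assumes "\<sigma> \<in> tree_automorphisms" "\<tau> \<in> tree_automorphisms"
  shows "Par (\<sigma> \<circ> \<tau>) x = Par \<tau> x + Par \<sigma> (\<tau> x)"
  using tree_automorphism_children[OF assms(1), of "\<tau> x"]
    tree_automorphism_children[OF assms(2), of x]
  by (auto simp: Par_def)

text \<open>This map is the section of \<open>\<tau>\<close> at \<open>y\<close>: it compares the
  subtrees at \<open>y\<close> and \<open>\<tau> y\<close> after deleting their roots, which have
  equal length. It is an injection of a finite level into itself, hence onto.\<close>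

lemma tree_automorphism_bij_words:
  assumes "\<tau> \<in> tree_automorphisms"
  shows "bij_betw (\<lambda>w. drop (length y) (\<tau> (y @ w))) (words n) (words n)"
proof -
  let ?f = "\<lambda>w. drop (length y) (\<tau> (y @ w))"
  have len: "length (\<tau> y) = length y" using assms by (auto simp: tree_automorphisms_def)
  have split: "\<tau> (y @ w) = \<tau> y @ ?f w \<and> length (?f w) = length w" for w
    using tree_automorphism_append[OF assms, of y w] len by (metis append_eq_conv_conj)
  have "inj_on ?f (words n)"
    by (rule inj_onI) (metis split tree_automorphism_inj[OF assms] same_append_eq)
  moreover have "?f ` words n \<subseteq> words n"
    using split by (auto simp: words_def)
  ultimately show ?thesis
    using finite_words by (metis bij_betw_def endo_inj_surj)
qed

lemma sum_Par_comp:
  assumes "\<sigma> \<in> tree_automorphisms" "\<tau> \<in> tree_automorphisms"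
  shows "(\<Sum>w\<in>words n. Par (\<sigma> \<circ> \<tau>) (y @ w)) =
    (\<Sum>w\<in>words n. Par \<tau> (y @ w)) + (\<Sum>w\<in>words n. Par \<sigma> (\<tau> y @ w))"
proof -
  have "length (\<tau> y) = length y" using assms(2) by (auto simp: tree_automorphisms_def)
  then have "\<tau> (y @ w) = \<tau> y @ drop (length y) (\<tau> (y @ w))" for w
    using tree_automorphism_append[OF assms(2), of y w] by (metis append_eq_conv_conj)
  \<comment> \<open>The section of \<open>\<tau>\<close> at \<open>y\<close> only permutes the
    summands.\<close>
  then have "(\<Sum>w\<in>words n. Par \<sigma> (\<tau> (y @ w))) = (\<Sum>w\<in>words n. Par \<sigma> (\<tau> y @ w))"
    using sum.reindex_bij_betw[OF tree_automorphism_bij_words[OF assms(2)],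
        of "\<lambda>v. Par \<sigma> (\<tau> y @ v)" y n] by simp
  then show ?thesis by (simp only: Par_comp[OF assms] sum.distrib)
qed

text \<open>Only \<open>\<sigma>\<close> is asked to have a common value; \<open>\<tau>\<close> may
  be any automorphism. This lets the lemma be applied to an inverse whose membership in
  \<open>Mrs r s\<close> is still to be shown.\<close>

lemma Pa_Pb_comp:
  assumes "\<sigma> \<in> tree_automorphisms" "\<tau> \<in> tree_automorphisms"
    and "\<And>x. Pa r s \<sigma> x = p" "\<And>x. Pb r s \<sigma> x = p"
  shows "Pa r s (\<sigma> \<circ> \<tau>) x = p + Pa r s \<tau> x" "Pb r s (\<sigma> \<circ> \<tau>) x = p + Pb r s \<tau> x"
proof -
  have comp: "(\<Sum>w\<in>words n. Par (\<sigma> \<circ> \<tau>) (x @ [c] @ w)) =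
      (\<Sum>w\<in>words n. Par \<tau> (x @ [c] @ w)) + (\<Sum>w\<in>words n. Par \<sigma> (\<tau> (x @ [c]) @ w))" for c n
    using sum_Par_comp[OF assms(1,2), of "x @ [c]" n] by (simp only: append_assoc)
  \<comment> \<open>Both readings of \<open>p\<close> are kept: if \<open>\<tau>\<close> swaps the
    children of \<open>x\<close>, the depths \<open>r\<close> and \<open>s\<close> trade sides at
    \<open>\<tau> x\<close>, so \<open>Pa\<close> and \<open>Pb\<close> of \<open>\<sigma>\<close>
    exchange roles.\<close>
  have p: "p = Pa r s \<sigma> (\<tau> x)" "p = Pb r s \<sigma> (\<tau> x)" using assms(3,4) by auto
  from tree_automorphism_children[OF assms(2), of x]
  show "Pa r s (\<sigma> \<circ> \<tau>) x = p + Pa r s \<tau> x"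
  proof (elim disjE conjE)
    assume "\<tau> (x @ [LetA]) = \<tau> x @ [LetA]" "\<tau> (x @ [LetB]) = \<tau> x @ [LetB]"
    then show ?thesis unfolding p(1) by (simp only: Pa_def comp append_assoc ac_simps)
  next
    assume "\<tau> (x @ [LetA]) = \<tau> x @ [LetB]" "\<tau> (x @ [LetB]) = \<tau> x @ [LetA]"
    then show ?thesis unfolding p(2) by (simp only: Pa_def Pb_def comp append_assoc ac_simps)
  qed
  from tree_automorphism_children[OF assms(2), of x]
  show "Pb r s (\<sigma> \<circ> \<tau>) x = p + Pb r s \<tau> x"
  proof (elim disjE conjE)
    assume "\<tau> (x @ [LetA]) = \<tau> x @ [LetA]" "\<tau> (x @ [LetB]) = \<tau> x @ [LetB]"
    then show ?thesis unfolding p(2) by (simp only: Pb_def comp append_assoc ac_simps)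
  next
    assume "\<tau> (x @ [LetA]) = \<tau> x @ [LetB]" "\<tau> (x @ [LetB]) = \<tau> x @ [LetA]"
    then show ?thesis unfolding p(1) by (simp only: Pa_def Pb_def comp append_assoc ac_simps)
  qed
qed

text \<open>A single witness \<open>p\<close> replaces the pairwise equalities, and it also
  determines the value that \<open>Prs\<close> selects by definite description.\<close>

lemma MrsI:
  assumes "\<sigma> \<in> tree_automorphisms" "\<And>x. Pa r s \<sigma> x = p" "\<And>x. Pb r s \<sigma> x = p"
  shows "\<sigma> \<in> Mrs r s" "Prs r s \<sigma> = p"
proof -
  show "\<sigma> \<in> Mrs r s" using assms by (simp add: Mrs_def AutT_def)
  from Prs_eq(1)[OF this] assms(2) show "Prs r s \<sigma> = p" by metis
qed

lemma Mrs_subset: "Mrs r s \<subseteq> tree_automorphisms"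
  by (auto simp: Mrs_def AutT_def)

lemma Mrs_comp:
  assumes "\<sigma> \<in> Mrs r s" "\<tau> \<in> Mrs r s"
  shows "\<sigma> \<circ> \<tau> \<in> Mrs r s" "Prs r s (\<sigma> \<circ> \<tau>) = Prs r s \<sigma> + Prs r s \<tau>"
proof -
  have aut: "\<sigma> \<in> tree_automorphisms" "\<tau> \<in> tree_automorphisms" using assms Mrs_subset by auto
  have comp: "\<sigma> \<circ> \<tau> \<in> tree_automorphisms"
    using group.is_monoid[OF group_AutT, THEN monoid.m_closed, of \<sigma> \<tau>] aut
    by (simp add: AutT_def)
  note eqs = Pa_Pb_comp[OF aut Prs_eq[OF assms(1)], unfolded Prs_eq[OF assms(2)]]
  show "\<sigma> \<circ> \<tau> \<in> Mrs r s" "Prs r s (\<sigma> \<circ> \<tau>) = Prs r s \<sigma> + Prs r s \<tau>"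
    using MrsI[OF comp eqs] .
qed

lemma Pa_Pb_id: "Pa r s id x = 0" "Pb r s id x = 0"
  by (simp_all add: Pa_def Pb_def Par_def)

lemma subgroup_Mrs: "subgroup (Mrs r s) AutT"
proof (rule group.subgroupI[OF group_AutT])
  show "Mrs r s \<subseteq> carrier AutT" by (auto simp: Mrs_def)
  have "id \<in> tree_automorphisms" by (simp add: tree_automorphisms_def)
  then show "Mrs r s \<noteq> {}" using MrsI(1)[OF _ Pa_Pb_id] by blast
  fix \<sigma> assume \<sigma>: "\<sigma> \<in> Mrs r s"
  then have car: "\<sigma> \<in> carrier AutT" by (simp add: Mrs_def)
  let ?\<tau> = "inv\<^bsub>AutT\<^esub> \<sigma>"
  have aut: "\<sigma> \<in> tree_automorphisms" "?\<tau> \<in> tree_automorphisms"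
    using car group.inv_closed[OF group_AutT car] by (simp_all add: AutT_def)
  have "\<sigma> \<circ> ?\<tau> = id"
    using group.r_inv[OF group_AutT car] by (simp add: AutT_def)
  \<comment> \<open>Both sums for the identity vanish, so the composition formula for
    \<open>\<sigma> \<circ> ?\<tau>\<close> can be solved for the values of the inverse, which
    therefore do not depend on \<open>x\<close>.\<close>
  then have "Prs r s \<sigma> + Pa r s ?\<tau> x = 0" "Prs r s \<sigma> + Pb r s ?\<tau> x = 0" for x
    using Pa_Pb_comp[OF aut Prs_eq[OF \<sigma>], of x] Pa_Pb_id by metis+
  then have "Pa r s ?\<tau> x = - Prs r s \<sigma>" "Pb r s ?\<tau> x = - Prs r s \<sigma>" for x
    by (metis add_eq_0_iff)+
  with aut(2) show "?\<tau> \<in> Mrs r s" by (rule MrsI(1))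
next
  fix \<sigma> \<tau> assume "\<sigma> \<in> Mrs r s" "\<tau> \<in> Mrs r s"
  then show "\<sigma> \<otimes>\<^bsub>AutT\<^esub> \<tau> \<in> Mrs r s" using Mrs_comp(1) by (simp add: AutT_def)
qed

lemma Prs_hom: "Prs r s \<in> hom (AutT\<lparr>carrier := Mrs r s\<rparr>) Z2_group"
  by (rule homI) (simp_all add: AutT_def Z2_group_def Mrs_comp(2))

lemma kernel_Prs: "kernel (AutT\<lparr>carrier := Mrs r s\<rparr>) Z2_group (Prs r s) = Brs r s"
  by (simp add: kernel_def Brs_def Z2_group_def)

theorem theorem3p3:
  fixes r s :: nat
  assumes "r > s" and "s \<ge> 1"
  shows "subgroup (Mrs r s) AutT \<and>
         subgroup (Brs r s) AutT \<and>
         Prs r s \<in> hom (AutT\<lparr>carrier := Mrs r s\<rparr>) Z2_group \<and>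
         kernel (AutT\<lparr>carrier := Mrs r s\<rparr>) Z2_group (Prs r s) = Brs r s"
proof -
  have "group_hom (AutT\<lparr>carrier := Mrs r s\<rparr>) Z2_group (Prs r s)"
    using Prs_hom group_Z2_group subgroup.subgroup_is_group[OF subgroup_Mrs group_AutT]
    by (intro group_hom.intro group_hom_axioms.intro)
  then have "subgroup (Brs r s) (AutT\<lparr>carrier := Mrs r s\<rparr>)"
    using group_hom.subgroup_kernel kernel_Prs by metis
  \<comment> \<open>As a kernel, \<open>Brs r s\<close> is a subgroup of \<open>Mrs r s\<close>;
    being a subgroup is transitive.\<close>
  then have "subgroup (Brs r s) AutT"
    by (rule group.incl_subgroup[OF group_AutT subgroup_Mrs])
  then show ?thesis using subgroup_Mrs Prs_hom kernel_Prs by blast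
qed

end
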